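(* Let $R$ be a ring. Then the following are equivalent: (1) Every nil-clean element of $R$ is uniquely nil-clean. (2) Every strongly nil-clean element of $R$ is uniquely nil-clean. (3) Every idempotent of $R$ is uniquely nil-clean. (4) $R$ is an abelian ring. (5) Every idempotent of $R$ commutes with all nilpotents of $R$, and $(\mathrm{nil}(R)+\mathrm{nil}(R))\cap \mathrm{idem}(R)=\{0\}$. (6) $(\mathrm{idem}(R)-\mathrm{idem}(R))\cap \mathrm{nil}(R)=\{0\}$.
   Context: All rings are associative with identity (not necessarily commutative). $\mathrm{nil}(R)$ is the set of nilpotent elements of $R$ and $\mathrm{idem}(R)$ is the set of idempotents of $R$. For subsets $A,B\subseteq R$, $A+B=\{a+b: a\in A, b\in B\}$ and $A-B=\{a-b: a\in A, b\in B\}$. An element $r\in R$ is nil-clean if $r=q+e$ for some $q\in \mathrm{nil}(R)$ and $e\in \mathrm{idem}(R)$; it is strongly nil-clean if such $q,e$ can be chosen with $qe=eq$; it is uniquely nil-clean if there is exactly one pair $(q,e)\in \mathrm{nil}(R)\times\mathrm{idem}(R)$ with $r=q+e$. A ring is abelian if all its idempotents are central. (A ring satisfying (1) is called an NCUNC-ring.) *)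

theory Defs
  imports "HOL-Algebra.Algebra"
begin

text \<open>Rings are those of the locale \<^locale>\<open>ring\<close>: associative with identity, not
  necessarily commutative, and the zero ring is allowed.\<close>

definition nil_elems :: "('a, 'b) ring_scheme \<Rightarrow> 'a set" where
  "nil_elems R = {x \<in> carrier R. \<exists>n::nat. 0 < n \<and> x [^]\<^bsub>R\<^esub> n = \<zero>\<^bsub>R\<^esub>}"

definition idem_elems :: "('a, 'b) ring_scheme \<Rightarrow> 'a set" where
  "idem_elems R = {e \<in> carrier R. e \<otimes>\<^bsub>R\<^esub> e = e}"

text \<open>The sum of two subsets is \<^const>\<open>set_add\<close> from the library.\<close>

definition set_minus :: "('a, 'b) ring_scheme \<Rightarrow> 'a set \<Rightarrow> 'a set \<Rightarrow> 'a set" where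
  "set_minus R A B = {a \<ominus>\<^bsub>R\<^esub> b | a b. a \<in> A \<and> b \<in> B}"

definition nil_clean :: "('a, 'b) ring_scheme \<Rightarrow> 'a \<Rightarrow> bool" where
  "nil_clean R r \<longleftrightarrow> (\<exists>q \<in> nil_elems R. \<exists>e \<in> idem_elems R. r = q \<oplus>\<^bsub>R\<^esub> e)"

definition strongly_nil_clean :: "('a, 'b) ring_scheme \<Rightarrow> 'a \<Rightarrow> bool" where
  "strongly_nil_clean R r \<longleftrightarrow>
    (\<exists>q \<in> nil_elems R. \<exists>e \<in> idem_elems R. r = q \<oplus>\<^bsub>R\<^esub> e \<and> q \<otimes>\<^bsub>R\<^esub> e = e \<otimes>\<^bsub>R\<^esub> q)"

definition uniquely_nil_clean :: "('a, 'b) ring_scheme \<Rightarrow> 'a \<Rightarrow> bool" where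
  "uniquely_nil_clean R r \<longleftrightarrow>
    (\<exists>!p. p \<in> nil_elems R \<times> idem_elems R \<and> r = fst p \<oplus>\<^bsub>R\<^esub> snd p)"

definition abelian_ring :: "('a, 'b) ring_scheme \<Rightarrow> bool" where
  "abelian_ring R \<longleftrightarrow>
    (\<forall>e \<in> idem_elems R. \<forall>x \<in> carrier R. e \<otimes>\<^bsub>R\<^esub> x = x \<otimes>\<^bsub>R\<^esub> e)"

definition NCUNC_ring :: "('a, 'b) ring_scheme \<Rightarrow> bool" where
  "NCUNC_ring R \<longleftrightarrow> (\<forall>r \<in> carrier R. nil_clean R r \<longrightarrow> uniquely_nil_clean R r)"

end

theory Submission
  imports Defs
begin

text \<open>For an idempotent \<open>e\<close> and any \<open>x\<close>, the element \<open>q = ex - exe\<close> satisfies \<open>eq = q\<close>,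
  \<open>qe = 0\<close>, so \<open>q\<close> squares to zero and \<open>e + q\<close> is idempotent; the same holds for
  \<open>q = xe - exe\<close> with the sides exchanged.  Each of the conditions applied to these
  elements forces \<open>q = 0\<close>, that is, \<open>e\<close> is central.  Conversely, a difference \<open>y\<close> of commuting
  idempotents satisfies \<open>y^3 = y\<close>, hence vanishes if it is nilpotent; and a sum of commuting
  nilpotents is nilpotent.\<close>

context ring
begin

section \<open>Nilpotent and idempotent elements: powers, commuting sums and differences\<close>

text \<open>Supplies the cancellation needed when sorting a sum by \<open>a_ac\<close> leaves a
  third term between \<open>x\<close> and its negative.\<close>

lemma add_minus_swap:
  assumes "x \<in> carrier R" and "y \<in> carrier R"
  shows "x \<oplus> (y \<oplus> \<ominus> x) = y"
  using assms by (simp add: a_comm[of y] r_neg2)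

lemma nil_elemsI:
  assumes "x \<in> carrier R" and "x [^] (n::nat) = \<zero>"
  shows "x \<in> nil_elems R"
proof -
  \<comment> \<open>\<open>nil_elems\<close> asks for a positive exponent; the extra factor also
    covers \<open>n = 0\<close>, where the hypothesis makes the ring zero.\<close>
  have "x [^] Suc n = \<zero>" using assms by simp
  then show ?thesis using assms(1) unfolding nil_elems_def by blast
qed

lemma zero_nil: "\<zero> \<in> nil_elems R"
  by (rule nil_elemsI[where n = 1]) auto

lemma zero_idem: "\<zero> \<in> idem_elems R"
  by (simp add: idem_elems_def)

lemma nil_uminus:
  assumes "q \<in> nil_elems R"
  shows "\<ominus> q \<in> nil_elems R"
proof -
  obtain n :: nat where q: "q \<in> carrier R" "q [^] n = \<zero>"
    using assms by (auto simp: nil_elems_def)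
  \<comment> \<open>The sign need not be tracked by parity, since both alternatives vanish once
    \<open>q [^] k\<close> does.\<close>
  have "(\<ominus> q) [^] k = q [^] k \<or> (\<ominus> q) [^] k = \<ominus> (q [^] k)" for k :: nat
    using q by (induction k) (auto simp: l_minus r_minus)
  from this[of n] have "(\<ominus> q) [^] n = \<zero>" using q by auto
  then show ?thesis using q by (intro nil_elemsI) auto
qed

text \<open>Writing \<open>y = p + q\<close>, an element \<open>w\<close> with \<open>wq = 0\<close> satisfies \<open>wy = wp\<close>, so \<open>w\<close> is killed by
  \<open>y^m\<close> as soon as \<open>p^m = 0\<close>; applying this to \<open>w = zq^n\<close> lowers the power of \<open>q\<close> one step at
  a time, which avoids the binomial theorem.\<close>

lemma commuting_sum_annihilates:
  assumes p: "p \<in> carrier R" "p [^] (m::nat) = \<zero>" and q: "q \<in> carrier R"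
    and comm: "p \<otimes> q = q \<otimes> p"
    and z: "z \<in> carrier R" "z \<otimes> q [^] (n::nat) = \<zero>"
  shows "z \<otimes> (p \<oplus> q) [^] (m * n) = \<zero>"
  using z
proof (induction n arbitrary: z)
  case 0
  then show ?case by simp
next
  case (Suc n)
  define y where "y = p \<oplus> q"
  have y: "y \<in> carrier R" using p q by (simp add: y_def)
  have qy: "q \<otimes> y = y \<otimes> q" and py: "p \<otimes> y = y \<otimes> p"
    using p q comm by (simp_all add: y_def l_distr r_distr)
  define w where "w = z \<otimes> q [^] n"
  have w: "w \<in> carrier R" "w \<otimes> q = \<zero>"
    using Suc.prems q by (simp_all add: w_def m_assoc)
  have wy: "w \<otimes> y = w \<otimes> p" using w p q by (simp add: y_def r_distr)
  have ypow: "y \<otimes> p [^] k = p [^] k \<otimes> y" for k :: nat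
    using py y p by (metis group_commutes_pow)
  have "w \<otimes> y [^] k = w \<otimes> p [^] k" for k :: nat
  proof (induction k)
    case (Suc k)
    have "w \<otimes> y [^] Suc k = (w \<otimes> y [^] k) \<otimes> y" using w y by (simp add: m_assoc)
    also have "\<dots> = (w \<otimes> y) \<otimes> p [^] k"
      using Suc.IH w y p ypow[of k] by (simp add: m_assoc)
    also have "\<dots> = w \<otimes> p [^] Suc k"
      using wy w p by (metis m_assoc nat_pow_Suc2 nat_pow_closed)
    finally show ?case .
  qed (use w in simp)
  from this[of m] have wym: "w \<otimes> y [^] m = \<zero>" using w p by simp
  \<comment> \<open>Moving \<open>y [^] m\<close> to the left of \<open>q [^] n\<close> turns
    \<open>w \<otimes> y [^] m = \<zero>\<close> into the hypothesis of the induction for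
    \<open>z \<otimes> y [^] m\<close> in place of \<open>z\<close>.\<close>
  have "q [^] n \<otimes> y [^] m = y [^] m \<otimes> q [^] n"
    using qy y q by (metis group_commutes_pow nat_pow_closed)
  then have "(z \<otimes> y [^] m) \<otimes> q [^] n = \<zero>"
    using wym Suc.prems q y by (simp add: w_def m_assoc)
  then have "(z \<otimes> y [^] m) \<otimes> y [^] (m * n) = \<zero>"
    using Suc.IH[of "z \<otimes> y [^] m"] Suc.prems y by (simp add: y_def)
  then show ?case
    using Suc.prems y by (simp add: m_assoc nat_pow_mult flip: y_def)
qed

lemma nil_add_commuting:
  assumes "p \<in> nil_elems R" and "q \<in> nil_elems R" and "p \<otimes> q = q \<otimes> p"
  shows "p \<oplus> q \<in> nil_elems R"
proof -
  obtain m n :: nat where p: "p \<in> carrier R" "p [^] m = \<zero>" and q: "q \<in> carrier R" "q [^] n = \<zero>"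
    using assms by (auto simp: nil_elems_def)
  have "\<one> \<otimes> (p \<oplus> q) [^] (m * n) = \<zero>"
    using commuting_sum_annihilates[OF p q(1) assms(3), of \<one> n] q by simp
  then show ?thesis using p q by (intro nil_elemsI) auto
qed

text \<open>All odd powers of \<open>y\<close> equal \<open>y\<close>, and the odd power
  \<open>2 * n + 1\<close> contains the vanishing factor \<open>y [^] n\<close>.\<close>

lemma nil_cube_eq_zero:
  assumes "y \<in> nil_elems R" and "y \<otimes> y \<otimes> y = y"
  shows "y = \<zero>"
proof -
  obtain n :: nat where y: "y \<in> carrier R" "y [^] n = \<zero>"
    using assms by (auto simp: nil_elems_def)
  have "y [^] (2 * k + 1) = y" for k :: nat
  proof (induction k)
    case (Suc k)
    have "2 * Suc k + 1 = Suc (Suc (2 * k + 1))" by simp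
    then have "y [^] (2 * Suc k + 1) = y [^] (2 * k + 1) \<otimes> y \<otimes> y"
      by (simp only: nat_pow_Suc)
    then show ?case using Suc.IH assms(2) by simp
  qed (use y in simp)
  moreover have "y [^] (2 * n + 1) = y [^] n \<otimes> y [^] (n + 1)"
    using nat_pow_mult[OF y(1), of n "n + 1"] by (simp only: mult_2 add.assoc)
  ultimately show ?thesis using y by simp
qed

lemma nil_idem_eq_zero:
  assumes "e \<in> nil_elems R" and "e \<in> idem_elems R"
  shows "e = \<zero>"
  using assms by (intro nil_cube_eq_zero) (auto simp: idem_elems_def)

text \<open>With \<open>g = e \<otimes> f\<close>, the elements \<open>e \<ominus> g\<close> and
  \<open>f \<ominus> g\<close> are orthogonal idempotents. Their difference is
  \<open>e \<ominus> f\<close> and their sum is its square, so a further factor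
  \<open>e \<ominus> f\<close> only restores the sign of the second one.\<close>

lemma commuting_idem_diff_cube:
  assumes "e \<in> idem_elems R" and "f \<in> idem_elems R" and comm: "e \<otimes> f = f \<otimes> e"
  shows "(e \<ominus> f) \<otimes> (e \<ominus> f) \<otimes> (e \<ominus> f) = e \<ominus> f"
proof -
  have e: "e \<in> carrier R" "e \<otimes> e = e" and f: "f \<in> carrier R" "f \<otimes> f = f"
    using assms by (auto simp: idem_elems_def)
  define g where "g = e \<otimes> f"
  have g: "g \<in> carrier R" "e \<otimes> f = g" "f \<otimes> e = g"
    using e f comm by (auto simp: g_def)
  have eg: "e \<otimes> g = g" "g \<otimes> f = g" "f \<otimes> g = g" "g \<otimes> e = g"
    using e f comm unfolding g_def by (metis m_assoc m_closed)+
  have "(e \<ominus> f) \<otimes> (e \<ominus> f) = (e \<ominus> g) \<oplus> (f \<ominus> g)"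
    using e f g by (simp add: minus_eq l_distr r_distr l_minus r_minus minus_add a_ac)
  also have "\<dots> \<otimes> (e \<ominus> f) = e \<ominus> f"
    using e f g eg
    by (simp add: minus_eq l_distr r_distr l_minus r_minus minus_add a_ac r_neg1 r_neg2 r_neg l_neg add_minus_swap)
  finally show ?thesis .
qed

section \<open>Conditions that force idempotents to be central\<close>

text \<open>Isolates what the proofs of centrality share: each condition then only has to rule out a
  nonzero \<open>q\<close> of this shape.\<close>

lemma abelian_ring_if_corners_vanish:
  assumes vanish: "\<And>e q. \<lbrakk>e \<in> idem_elems R; q \<in> nil_elems R; e \<oplus> q \<in> idem_elems R;
      e \<otimes> q = q \<and> q \<otimes> e = \<zero> \<or> q \<otimes> e = q \<and> e \<otimes> q = \<zero>\<rbrakk> \<Longrightarrow> q = \<zero>"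
  shows "abelian_ring R"
  unfolding abelian_ring_def
proof (intro ballI)
  fix e x assume ei: "e \<in> idem_elems R" and x: "x \<in> carrier R"
  have e: "e \<in> carrier R" "e \<otimes> e = e" using ei by (auto simp: idem_elems_def)
  have ee: "e \<otimes> (e \<otimes> t) = e \<otimes> t" if "t \<in> carrier R" for t
    using e that by (metis m_assoc)
  have corner_zero: "q = \<zero>"
    if q: "q \<in> carrier R"
      and c: "e \<otimes> q = q \<and> q \<otimes> e = \<zero> \<or> q \<otimes> e = q \<and> e \<otimes> q = \<zero>" for q
  proof (rule vanish[OF ei _ _ c])
    \<comment> \<open>Inserting \<open>e\<close> between the two factors does not change the
      product, yet creates a factor \<open>q \<otimes> e\<close> or \<open>e \<otimes> q\<close>
      that is zero.\<close>
    have qq: "q \<otimes> q = \<zero>"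
    proof (cases "q \<otimes> e = \<zero>")
      case True
      then show ?thesis using c e q by (metis m_assoc l_null)
    next
      case False
      then show ?thesis using c e q by (metis m_assoc r_null)
    qed
    then show "q \<in> nil_elems R" using q by (intro nil_elemsI[where n = 2]) (auto simp: numeral_2_eq_2)
    show "e \<oplus> q \<in> idem_elems R"
      using c e q qq by (auto simp: idem_elems_def l_distr r_distr)
  qed
  \<comment> \<open>The two differences are the components of \<open>x\<close> in
    \<open>eR(1-e)\<close> and \<open>(1-e)Re\<close>, one for each alternative of
    \<open>c\<close>.\<close>
  have "e \<otimes> x \<ominus> e \<otimes> x \<otimes> e = \<zero>"
    by (rule corner_zero)
      (use e x ee in \<open>auto simp: minus_eq l_distr r_distr l_minus r_minus m_assoc r_neg\<close>)
  moreover have "x \<otimes> e \<ominus> e \<otimes> x \<otimes> e = \<zero>"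
    by (rule corner_zero)
      (use e x ee in \<open>auto simp: minus_eq l_distr r_distr l_minus r_minus m_assoc r_neg\<close>)
  ultimately show "e \<otimes> x = x \<otimes> e" using e x by simp
qed

lemma uniquely_nil_cleanD:
  assumes "uniquely_nil_clean R r"
    and "q \<in> nil_elems R" "e \<in> idem_elems R" "r = q \<oplus> e"
    and "p \<in> nil_elems R" "f \<in> idem_elems R" "r = p \<oplus> f"
  shows "q = p"
proof -
  obtain c where "\<And>p. p \<in> nil_elems R \<times> idem_elems R \<and> r = fst p \<oplus> snd p \<Longrightarrow> p = c"
    using assms(1) unfolding uniquely_nil_clean_def by blast
  from this[of "(q, e)"] this[of "(p, f)"] have "(q, e) = (p, f)" using assms(2-7) by simp
  then show ?thesis by simp
qed

text \<open>The idempotent \<open>e \<oplus> q\<close> has the nilpotent part \<open>q\<close> next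
  to \<open>e\<close>, and the nilpotent part \<open>\<zero>\<close> next to itself; uniqueness
  identifies the two.\<close>

lemma idem_uniquely_nil_clean_imp_abelian:
  assumes "\<forall>r \<in> idem_elems R. uniquely_nil_clean R r"
  shows "abelian_ring R"
proof (rule abelian_ring_if_corners_vanish)
  fix e q assume *: "e \<in> idem_elems R" "q \<in> nil_elems R" "e \<oplus> q \<in> idem_elems R"
  then have "e \<in> carrier R" "q \<in> carrier R" by (auto simp: idem_elems_def nil_elems_def)
  then show "q = \<zero>"
    using * assms zero_nil
    by (intro uniquely_nil_cleanD[of "e \<oplus> q" q e \<zero> "e \<oplus> q"]) (auto simp: a_comm)
qed

lemma idem_diff_inter_nil_imp_abelian:
  assumes "set_minus R (idem_elems R) (idem_elems R) \<inter> nil_elems R = {\<zero>}"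
  shows "abelian_ring R"
proof (rule abelian_ring_if_corners_vanish)
  fix e q assume *: "e \<in> idem_elems R" "q \<in> nil_elems R" "e \<oplus> q \<in> idem_elems R"
  then have "e \<in> carrier R" "q \<in> carrier R" by (auto simp: idem_elems_def nil_elems_def)
  then have "q = (e \<oplus> q) \<ominus> e" by (simp add: minus_eq a_ac r_neg1 add_minus_swap)
  then have "q \<in> set_minus R (idem_elems R) (idem_elems R)"
    using * unfolding set_minus_def by blast
  then show "q = \<zero>" using * assms by blast
qed

lemma idem_nil_commute_imp_abelian:
  assumes "\<forall>e \<in> idem_elems R. \<forall>q \<in> nil_elems R. e \<otimes> q = q \<otimes> e"
  shows "abelian_ring R"
proof (rule abelian_ring_if_corners_vanish)
  fix e q assume "e \<in> idem_elems R" "q \<in> nil_elems R"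
    and c: "e \<otimes> q = q \<and> q \<otimes> e = \<zero> \<or> q \<otimes> e = q \<and> e \<otimes> q = \<zero>"
  then have "e \<otimes> q = q \<otimes> e" using assms by blast
  with c show "q = \<zero>" by auto
qed

section \<open>Consequences of central idempotents\<close>

lemma abelian_idem_diff_nil:
  assumes "abelian_ring R" "e \<in> idem_elems R" "f \<in> idem_elems R" "e \<ominus> f \<in> nil_elems R"
  shows "e = f"
proof -
  have "e \<in> carrier R" "f \<in> carrier R" "e \<otimes> f = f \<otimes> e"
    using assms by (auto simp: abelian_ring_def idem_elems_def)
  then show ?thesis
    using nil_cube_eq_zero[OF assms(4) commuting_idem_diff_cube] assms by simp
qed

lemma abelian_imp_idem_diff_inter_nil:
  assumes "abelian_ring R"
  shows "set_minus R (idem_elems R) (idem_elems R) \<inter> nil_elems R = {\<zero>}"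
proof
  show "set_minus R (idem_elems R) (idem_elems R) \<inter> nil_elems R \<subseteq> {\<zero>}"
  proof
    fix x assume "x \<in> set_minus R (idem_elems R) (idem_elems R) \<inter> nil_elems R"
    then obtain e f where *: "e \<in> idem_elems R" "f \<in> idem_elems R" "x = e \<ominus> f"
        "e \<ominus> f \<in> nil_elems R"
      by (auto simp: set_minus_def)
    then have "e = f" using abelian_idem_diff_nil[OF assms] by blast
    then show "x \<in> {\<zero>}" using * by (simp add: idem_elems_def)
  qed
  have "\<zero> = \<zero> \<ominus> \<zero>" by (simp add: minus_eq)
  then show "{\<zero>} \<subseteq> set_minus R (idem_elems R) (idem_elems R) \<inter> nil_elems R"
    using zero_idem zero_nil unfolding set_minus_def by blast
qed

lemma abelian_imp_nil_sum_inter_idem: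
  assumes "abelian_ring R"
  shows "(nil_elems R <+> nil_elems R) \<inter> idem_elems R = {\<zero>}"
proof
  show "(nil_elems R <+> nil_elems R) \<inter> idem_elems R \<subseteq> {\<zero>}"
  proof
    fix e assume "e \<in> (nil_elems R <+> nil_elems R) \<inter> idem_elems R"
    then obtain p q where *: "e \<in> idem_elems R" "p \<in> nil_elems R" "q \<in> nil_elems R" "e = p \<oplus> q"
      by (auto simp: set_add_def')
    then have pq: "p \<in> carrier R" "q \<in> carrier R" by (auto simp: nil_elems_def)
    \<comment> \<open>The sum is a central idempotent; cancelling \<open>p \<otimes> p\<close> shows
      that its summands commute, so the sum is nilpotent as well.\<close>
    have "(p \<oplus> q) \<otimes> p = p \<otimes> (p \<oplus> q)"
      using assms * pq by (auto simp: abelian_ring_def)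
    then have "p \<otimes> q = q \<otimes> p" using pq by (simp add: l_distr r_distr)
    then show "e \<in> {\<zero>}" using * nil_add_commuting nil_idem_eq_zero by auto
  qed
  have "\<zero> = \<zero> \<oplus> \<zero>" by simp
  then show "{\<zero>} \<subseteq> (nil_elems R <+> nil_elems R) \<inter> idem_elems R"
    using zero_idem zero_nil unfolding set_add_def' by blast
qed

text \<open>Given two decompositions of one element, \<open>q\<close> commutes with
  \<open>q \<oplus> e = p \<oplus> f\<close> and with the central \<open>f\<close>, hence with
  \<open>p\<close>. So \<open>p \<ominus> q = e \<ominus> f\<close> is a nilpotent difference of
  idempotents.\<close>

lemma abelian_imp_NCUNC:
  assumes ab: "abelian_ring R"
  shows "NCUNC_ring R"
proof -
  have "q = p \<and> e = f"
    if q: "q \<in> nil_elems R" and p: "p \<in> nil_elems R"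
      and e: "e \<in> idem_elems R" and f: "f \<in> idem_elems R" and eq: "q \<oplus> e = p \<oplus> f" for p q e f
  proof -
    have c: "q \<in> carrier R" "p \<in> carrier R" "e \<in> carrier R" "f \<in> carrier R"
      using q p e f by (auto simp: nil_elems_def idem_elems_def)
    have "q \<otimes> e = e \<otimes> q" "q \<otimes> f = f \<otimes> q"
      using ab e f c by (auto simp: abelian_ring_def)
    moreover have "q \<otimes> (p \<oplus> f) = q \<otimes> (q \<oplus> e)" "(p \<oplus> f) \<otimes> q = (q \<oplus> e) \<otimes> q"
      using eq by simp_all
    ultimately have "q \<otimes> p = p \<otimes> q"
      using c by (simp add: l_distr r_distr) (metis add.r_cancel m_closed)
    then have "p \<otimes> (\<ominus> q) = (\<ominus> q) \<otimes> p" using c by (simp add: l_minus r_minus)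
    then have "p \<oplus> \<ominus> q \<in> nil_elems R" using nil_add_commuting nil_uminus p q by blast
    moreover have "p \<oplus> \<ominus> q = e \<ominus> f"
    proof -
      have "p = (q \<oplus> e) \<ominus> f" using c eq by (simp add: minus_eq a_assoc r_neg)
      then show ?thesis using c by (simp add: minus_eq a_ac r_neg1 add_minus_swap)
    qed
    ultimately have "e = f" using abelian_idem_diff_nil[OF ab e f] by simp
    then show ?thesis using eq c by simp
  qed
  then show ?thesis
    unfolding NCUNC_ring_def nil_clean_def uniquely_nil_clean_def
    by (intro ballI impI) (elim bexE, rule_tac a = "(q, e)" in ex1I, auto)
qed

lemma strongly_nil_clean_imp_nil_clean: "strongly_nil_clean R r \<Longrightarrow> nil_clean R r"
  by (auto simp: strongly_nil_clean_def nil_clean_def)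

lemma idem_strongly_nil_clean:
  assumes "e \<in> idem_elems R"
  shows "strongly_nil_clean R e"
proof -
  have "e \<in> carrier R" using assms by (simp add: idem_elems_def)
  then have "e = \<zero> \<oplus> e \<and> \<zero> \<otimes> e = e \<otimes> \<zero>" by simp
  then show ?thesis using assms zero_nil unfolding strongly_nil_clean_def by blast
qed

end

theorem theorem2p2:
  fixes R :: "('a, 'b) ring_scheme"
  assumes "ring R"
  shows "(NCUNC_ring R \<longleftrightarrow>
            (\<forall>r \<in> carrier R. strongly_nil_clean R r \<longrightarrow> uniquely_nil_clean R r)) \<and>
         (NCUNC_ring R \<longleftrightarrow> (\<forall>r \<in> idem_elems R. uniquely_nil_clean R r)) \<and>
         (NCUNC_ring R \<longleftrightarrow> abelian_ring R) \<and>
         (NCUNC_ring R \<longleftrightarrow>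
            (\<forall>e \<in> idem_elems R. \<forall>q \<in> nil_elems R. e \<otimes>\<^bsub>R\<^esub> q = q \<otimes>\<^bsub>R\<^esub> e) \<and>
            (nil_elems R <+>\<^bsub>R\<^esub> nil_elems R) \<inter> idem_elems R = {\<zero>\<^bsub>R\<^esub>}) \<and>
         (NCUNC_ring R \<longleftrightarrow>
            set_minus R (idem_elems R) (idem_elems R) \<inter> nil_elems R = {\<zero>\<^bsub>R\<^esub>})"
proof -
  interpret ring R by fact
  have 12: "\<forall>r \<in> carrier R. strongly_nil_clean R r \<longrightarrow> uniquely_nil_clean R r"
    if "NCUNC_ring R"
    using that strongly_nil_clean_imp_nil_clean unfolding NCUNC_ring_def by blast
  have 23: "\<forall>r \<in> idem_elems R. uniquely_nil_clean R r"
    if "\<forall>r \<in> carrier R. strongly_nil_clean R r \<longrightarrow> uniquely_nil_clean R r"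
    using that idem_strongly_nil_clean by (auto simp: idem_elems_def)
  have 45: "\<forall>e \<in> idem_elems R. \<forall>q \<in> nil_elems R. e \<otimes>\<^bsub>R\<^esub> q = q \<otimes>\<^bsub>R\<^esub> e" if "abelian_ring R"
    using that by (auto simp: abelian_ring_def nil_elems_def)
  \<comment> \<open>Uniqueness passes from nil-clean to strongly nil-clean elements and on to
    idempotents, which makes them central, and this closes the cycle. The conditions on commutation
    and on differences are each tied to \<open>abelian_ring R\<close>.\<close>
  show ?thesis
    using 12 23 idem_uniquely_nil_clean_imp_abelian abelian_imp_NCUNC
      45 abelian_imp_nil_sum_inter_idem idem_nil_commute_imp_abelian
      abelian_imp_idem_diff_inter_nil idem_diff_inter_nil_imp_abelian
    by blast
qed

end
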